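(* For every index $n$ of the Fibonacci sequence $(F_n)_{n\ge 1}$, $F_{n+1}!$ has at least one divisor more than $F_n!$. Moreover, let $A_{n+1}$ be the set of all the primes $\le F_{n+1}$ and let $A_n$ be the set of all the primes $\le F_n$; then $A_{n+1}>A_n$, meaning that $A_{n+1}$ has at least one element more than $A_n$.
   Context: $(F_n)_{n\ge 1}$ is the Fibonacci sequence, with $F_1=F_2=1$ and $F_{n+2}=F_{n+1}+F_n$. For a positive integer $m$, $m!$ denotes its factorial.
   Formalization: The claim is proved for every index n ≥ 2; the index n = 1 is excluded because F_1 = F_2 = 1, so both F_1! and F_2! equal 1 and both prime sets are empty, and both assertions fail there. *)

theory Defs
  imports "HOL-Number_Theory.Number_Theory"
begin

end

theory Submission imports Defs "HOL-Analysis.Harmonic_Numbers" begin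

text \<open>
  Everything follows from the existence of a prime \<open>p\<close> with \<open>F\<^sub>n < p \<le> F\<^sub>n\<^sub>+\<^sub>1\<close>. As
  \<open>F\<^sub>n\<^sub>+\<^sub>1 / F\<^sub>n \<ge> 8/5\<close> for \<open>n \<ge> 4\<close>, this is a sharpened Bertrand postulate, which we obtain by
  Chebyshev's method. With \<open>T(x) = ln \<lfloor>x\<rfloor>!\<close>, the combination
  \<open>\<alpha>(x) = T(x) - T(x/2) - T(x/3) - T(x/4) + T(x/12)\<close> is a sum of \<open>\<Lambda>(d)\<close> with weights in
  \<open>{0, 1}\<close> that equal 1 when \<open>1 \<le> x/d < 4\<close>, so \<open>\<psi>(x) - \<psi>(x/4) \<le> \<alpha>(x) \<le> \<psi>(x)\<close>. Stirling's formula
  gives \<open>\<alpha>(x) = c x + O(ln x)\<close>, so \<open>\<psi>(x)\<close> lies between \<open>c x\<close> and \<open>4/3 c x\<close> up to \<open>O(ln\<^sup>2 x)\<close>, and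
  \<open>8/5 > 4/3\<close>. Proper prime powers contribute only \<open>O(\<surd>x ln x)\<close>. The range below 10000 is a finite check.
\<close>

section \<open>Sums of von Mangoldt weights\<close>

definition psi :: "nat \<Rightarrow> real" where
  "psi n = (\<Sum>d=1..n. mangoldt d)"

definition alpha :: "nat \<Rightarrow> real" where
  "alpha n = ln (fact n) - ln (fact (n div 2)) - ln (fact (n div 3)) - ln (fact (n div 4))
     + ln (fact (n div 12))"

text \<open>Passing from \<open>n\<close> to \<open>Suc n\<close> adds \<open>ln (Suc n)\<close>,
  the sum of \<open>mangoldt\<close> over the divisors of \<open>Suc n\<close>, and
  \<open>n div d\<close> jumps exactly at those \<open>d\<close>. The free upper end
  \<open>N\<close> lets all five factorials in \<open>alpha\<close> share one summation
  range.\<close>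

lemma ln_fact_eq_sum_mangoldt:
  assumes "n \<le> N"
  shows "ln (fact n :: real) = (\<Sum>d=1..N. mangoldt d * real (n div d))"
  using assms
proof (induction n)
  case 0
  then show ?case by simp
next
  case (Suc n)
  have "ln (fact (Suc n) :: real) = ln (real (Suc n)) + ln (fact n)"
    by (simp only: fact_Suc of_nat_mult) (subst ln_mult, auto)
  also have "ln (real (Suc n)) = (\<Sum>d | d dvd Suc n. mangoldt d)"
    using mangoldt_sum[of "Suc n", where 'a = real] by simp
  also have "\<dots> = (\<Sum>d=1..N. if d dvd Suc n then mangoldt d else 0)"
  proof -
    have "{d. d dvd Suc n} = {d \<in> {1..N}. d dvd Suc n}"
      using Suc.prems by (auto dest: dvd_imp_le intro!: Suc_leI Nat.gr0I)
    then show ?thesis by (simp only: sum.inter_filter[symmetric] finite_atLeastAtMost)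
  qed
  also have "ln (fact n :: real) = (\<Sum>d=1..N. mangoldt d * real (n div d))"
    using Suc by simp
  finally show ?case
    unfolding sum.distrib[symmetric]
    by (auto intro!: sum.cong simp: div_Suc dvd_eq_mod_eq_0 algebra_simps)
qed

lemma alpha_eq_sum:
  "alpha n = (\<Sum>d=1..n. mangoldt d *
     real_of_int (let q = int (n div d) in q - q div 2 - q div 3 - q div 4 + q div 12))"
proof -
  have swap: "n div k div d = n div d div k" for k d
    by (simp add: div_mult2_eq[symmetric] mult.commute)
  have T: "ln (fact (n div k) :: real)
      = (\<Sum>d=1..n. mangoldt d * real_of_int (int (n div d) div int k))" for k
    by (subst ln_fact_eq_sum_mangoldt[of _ n]) (simp_all only: swap div_le_dividend of_int_of_nat_eq flip: zdiv_int)
  have T0: "ln (fact n :: real) = (\<Sum>d=1..n. mangoldt d * real_of_int (int (n div d)))"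
    by (subst ln_fact_eq_sum_mangoldt[of _ n]) auto
  show ?thesis
    unfolding alpha_def T0 T sum_subtractf[symmetric] sum.distrib[symmetric]
    by (intro sum.cong) (auto simp: Let_def algebra_simps)
qed

text \<open>As 12 - 6 - 4 - 3 + 1 = 0, the combination depends only on \<open>q mod 12\<close>,
  which leaves twelve residues to inspect.\<close>

lemma floor_comb_bounds:
  fixes q :: int
  defines "f \<equiv> q - q div 2 - q div 3 - q div 4 + q div 12"
  shows "0 \<le> f" and "f \<le> 1"
proof -
  define a r where "a = q div 12" and "r = q mod 12"
  have q: "q = 12 * a + r" and r: "0 \<le> r" "r < 12" by (simp_all add: a_def r_def)
  have "q div 2 = 6 * a + r div 2" "q div 3 = 4 * a + r div 3" "q div 4 = 3 * a + r div 4"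
    unfolding q by presburger+
  then have f: "f = r - r div 2 - r div 3 - r div 4"
    unfolding f_def a_def[symmetric] using q by simp
  have "r \<in> set [0..11]" using r by simp
  then have "r \<in> {0,1,2,3,4,5,6,7,8,9,10,11}"
    by (simp add: upto_rec1 del: set_upto)
  then show "0 \<le> f" and "f \<le> 1" unfolding f by auto
qed

lemma alpha_le_psi: "alpha n \<le> psi n"
  unfolding alpha_eq_sum psi_def Let_def
  by (intro sum_mono mult_left_le) (simp_all only: mangoldt_nonneg of_int_le_1_iff floor_comb_bounds)

lemma psi_diff_le_alpha: "psi n - psi (n div 4) \<le> alpha n"
proof -
  have "psi n = psi (n div 4) + (\<Sum>d\<in>{n div 4<..n}. mangoldt d)"
    unfolding psi_def by (subst sum.union_disjoint[symmetric]) (auto intro!: sum.cong)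
  also have "(\<Sum>d\<in>{n div 4<..n}. mangoldt d)
      = (\<Sum>d=1..n. if n div 4 < d then mangoldt d else (0::real))"
    by (subst sum.inter_filter[symmetric]) (auto intro!: sum.cong)
  also have "\<dots> \<le> alpha n"
    unfolding alpha_eq_sum Let_def
  proof (intro sum_mono)
    fix d assume d: "d \<in> {1..n}"
    define q where "q = int (n div d)"
    have nonneg: "0 \<le> q - q div 2 - q div 3 - q div 4 + q div 12"
      by (rule floor_comb_bounds)
    have pos: "1 \<le> q - q div 2 - q div 3 - q div 4 + q div 12" if "n div 4 < d"
    proof -
      have "n < 4 * d" using that by linarith
      then have "n div d < 4" by (simp add: less_mult_imp_div_less)
      moreover have "n div d \<ge> 1" using d by (simp add: div_greater_zero_iff Suc_le_eq)
      ultimately have "q = 1 \<or> q = 2 \<or> q = 3" unfolding q_def by linarith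
      then show ?thesis by auto
    qed
    show "(if n div 4 < d then mangoldt d else 0) \<le> mangoldt d *
        real_of_int (int (n div d) - int (n div d) div 2 - int (n div d) div 3
          - int (n div d) div 4 + int (n div d) div 12)"
      unfolding q_def[symmetric]
    proof (cases "n div 4 < d")
      case True
      have "mangoldt d * (1::real) \<le> mangoldt d *
          real_of_int (q - q div 2 - q div 3 - q div 4 + q div 12)"
        using pos[OF True] by (intro mult_left_mono mangoldt_nonneg) (simp only: of_int_1_le_iff)
      then show "(if n div 4 < d then mangoldt d else 0) \<le> mangoldt d *
          real_of_int (q - q div 2 - q div 3 - q div 4 + q div 12)"
        using True by simp
    next
      case False
      then show "(if n div 4 < d then mangoldt d else 0) \<le> mangoldt d *
          real_of_int (q - q div 2 - q div 3 - q div 4 + q div 12)"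
        using nonneg by (simp only: if_False) (intro mult_nonneg_nonneg mangoldt_nonneg,
          simp only: of_int_0_le_iff)
    qed
  qed
  finally show ?thesis by simp
qed

section \<open>Stirling bounds and the size of \<open>alpha\<close>\<close>

text \<open>Induction from n (ln (n+1) - ln n) \<le> 1 \<le> (n+1) (ln (n+1) - ln n); the left
  inequality drives the lower bound, the right one the upper bound.\<close>

lemma ln_fact_bounds:
  assumes "n \<ge> 1"
  shows "real n * ln n - n + 1 \<le> ln (fact n)"
    and "ln (fact n) \<le> real n * ln n - n + ln n + 1"
proof -
  have "real n * ln n - n + 1 \<le> ln (fact n) \<and> ln (fact n) \<le> real n * ln n - n + ln n + 1"
    using assms
  proof (induction n rule: dec_induct)
    case base
    show ?case by simp
  next
    case (step n)
    have f: "ln (fact (Suc n) :: real) = ln (real (Suc n)) + ln (fact n)"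
      by (simp only: fact_Suc of_nat_mult) (subst ln_mult, auto)
    have n: "real n > 0" using step.hyps by simp
    have "ln (real (Suc n)) - ln (real n) \<le> (real (Suc n) - real n) / real n"
      by (rule ln_diff_le) (use n in auto)
    then have a: "real n * ln (real (Suc n)) \<le> real n * ln n + 1"
      using n by (simp add: field_simps)
    have "ln (real n) - ln (real (Suc n)) \<le> (real n - real (Suc n)) / real (Suc n)"
      by (rule ln_diff_le) (use n in auto)
    then have "(ln (real n) - ln (real (Suc n))) * real (Suc n) \<le> real n - real (Suc n)"
      by (subst (asm) pos_le_divide_eq) auto
    then have b: "real n * ln n + ln n + 1 \<le> real n * ln (real (Suc n)) + ln (real (Suc n))"
      by (simp add: algebra_simps)
    show ?case unfolding f using a b step.IH by (simp add: algebra_simps)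
  qed
  then show "real n * ln n - n + 1 \<le> ln (fact n)"
    and "ln (fact n) \<le> real n * ln n - n + ln n + 1" by auto
qed

text \<open>Used with \<open>x = n / k\<close> for the factorial of \<open>n div k\<close>: rounding
  then costs only \<open>ln x\<close>, and the main terms of \<open>alpha\<close> cancel
  exactly.\<close>

lemma ln_fact_bounds_real:
  fixes x :: real
  assumes "n \<ge> 1" "real n \<le> x" "x \<le> real n + 1"
  shows "x * ln x - x - ln x + 1 \<le> ln (fact n)"
    and "ln (fact n) \<le> x * ln x - x + ln x + 1"
proof -
  have n: "real n \<ge> 1" and x: "x \<ge> 1" using assms by auto
  have lnx: "ln x \<ge> 0" using x by simp
  have "ln x - ln (real n) \<le> (x - real n) / real n" by (rule ln_diff_le) (use n x in auto)
  then have "real n * ln x \<le> real n * ln n + x - n" using n by (simp add: field_simps)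
  moreover have "(x - real n) * ln x \<le> 1 * ln x"
    using assms lnx by (intro mult_right_mono) auto
  ultimately show "x * ln x - x - ln x + 1 \<le> ln (fact n)"
    using ln_fact_bounds(1)[OF assms(1)] by (simp add: algebra_simps)
  have "ln (real n) - ln x \<le> (real n - x) / x" by (rule ln_diff_le) (use n x in auto)
  then have "x * ln n \<le> x * ln x + n - x" using x by (simp add: field_simps)
  moreover have "0 \<le> (x - real n) * ln n" using assms n by simp
  moreover have "ln (real n) \<le> ln x" using n assms by simp
  ultimately show "ln (fact n) \<le> x * ln x - x + ln x + 1"
    using ln_fact_bounds(2)[OF assms(1)] by (simp add: algebra_simps)
qed

lemma ln_fact_div_bounds:
  fixes n k :: nat
  assumes "k \<ge> 1" "k \<le> n"
  defines "h \<equiv> real n / k * (ln n - ln k) - real n / k"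
  shows "h - (ln n - ln k) + 1 \<le> ln (fact (n div k))"
    and "ln (fact (n div k)) \<le> h + (ln n - ln k) + 1"
proof -
  have 1: "n div k \<ge> 1" using assms by (simp add: div_greater_zero_iff Suc_le_eq)
  have 2: "real (n div k) \<le> real n / k" by (rule of_nat_div_le_of_nat)
  have 3: "real n / k \<le> real (n div k) + 1"
  proof -
    have "n < (n div k + 1) * k" using assms by (simp add: dividend_less_div_times)
    then have "real n < (real (n div k) + 1) * real k"
      by (metis of_nat_1 of_nat_add of_nat_less_iff of_nat_mult)
    then show ?thesis using assms by (simp add: pos_divide_le_eq)
  qed
  have l: "ln (real n / k) = ln n - ln k" using assms by (simp add: ln_div)
  show "h - (ln n - ln k) + 1 \<le> ln (fact (n div k))"
    and "ln (fact (n div k)) \<le> h + (ln n - ln k) + 1"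
    using ln_fact_bounds_real[OF 1 2 3] unfolding l h_def by auto
qed

text \<open>The linear terms of \<open>\<alpha>\<close> sum to
  \<open>n (ln 2 / 2 + ln 3 / 3 + ln 4 / 4 - ln 12 / 12)\<close>; the terms \<open>n ln n\<close> and \<open>-n\<close> cancel as
  \<open>1 - 1/2 - 1/3 - 1/4 + 1/12 = 0\<close>.\<close>

definition cheb :: real where
  "cheb = 5 / 6 * ln 2 + ln 3 / 4"

lemma ln_3_ge_1: "ln 3 \<ge> (1::real)"
  using exp_le by (subst ln_ge_iff) auto

lemma ln_4_12:
  shows "ln 4 = 2 * ln (2::real)" and "ln 12 = 2 * ln 2 + ln (3::real)"
proof -
  show 4: "ln 4 = 2 * ln (2::real)" using ln_mult[of 2 "2::real"] by simp
  show "ln 12 = 2 * ln 2 + ln (3::real)" using ln_mult[of 4 "3::real"] 4 by simp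
qed

text \<open>The hypothesis makes even \<open>n div 12\<close> positive. The -6 comes from the summed
  constant -1 and from -5 ln 2 - 2 ln 3, using ln 2 \<ge> 2/3 and ln 3 \<ge> 1.\<close>

lemma alpha_bounds:
  assumes "n \<ge> 12"
  shows "cheb * n - 4 * ln n \<le> alpha n" and "alpha n \<le> cheb * n + 5 * ln n - 6"
proof -
  note b1 = ln_fact_bounds[of n]
  note b2 = ln_fact_div_bounds[of 2 n]
  note b3 = ln_fact_div_bounds[of 3 n]
  note b4 = ln_fact_div_bounds[of 4 n]
  note b12 = ln_fact_div_bounds[of 12 n]
  note bs = b1 b2 b3 b4 b12
  have l: "ln (real n) \<ge> 0" using assms by simp
  note lns = ln_4_12 ln_3_ge_1 ln2_ge_two_thirds l
  show "cheb * n - 4 * ln n \<le> alpha n"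
    using bs(1,4,6,8,9) lns assms unfolding alpha_def cheb_def
    by (simp add: algebra_simps)
  show "alpha n \<le> cheb * n + 5 * ln n - 6"
    using bs(2,3,5,7,10) lns assms unfolding alpha_def cheb_def
    by (simp add: algebra_simps)
qed

section \<open>Upper bound for \<open>psi\<close>\<close>

lemma cheb_ge: "cheb \<ge> 4 / 5"
  using ln2_ge_two_thirds ln_3_ge_1 by (simp add: cheb_def)

text \<open>A crude bound for the range \<open>n < 12\<close>, which \<open>alpha_bounds\<close>
  does not cover.\<close>

lemma psi_le_ln_fact: "psi n \<le> ln (fact n)"
proof -
  have "mangoldt d * 1 \<le> mangoldt d * real (n div d)" if "d \<in> {1..n}" for d
  proof -
    have "n div d \<ge> 1" using that by (simp add: div_greater_zero_iff Suc_le_eq)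
    then show ?thesis by (intro mult_left_mono mangoldt_nonneg) simp
  qed
  then show ?thesis
    unfolding psi_def ln_fact_eq_sum_mangoldt[OF order.refl] by (intro sum_mono) simp
qed

text \<open>Iterating \<open>psi_diff_le_alpha\<close> gives the geometric series 1 + 1/4 + 1/16 +
  ... = 4/3; the logarithmic errors of the steps add up to a squared logarithm.\<close>

lemma psi_upper:
  assumes "n \<ge> 1"
  shows "psi n \<le> 4 / 3 * cheb * n + 2 * (ln n)\<^sup>2 + 20"
  using assms
proof (induction n rule: less_induct)
  case (less n)
  show ?case
  proof (cases "n < 12")
    case True
    have "fact n \<le> (fact 11 :: real)" using True by (intro fact_mono) auto
    also have "\<dots> \<le> 2 ^ 26" by (simp add: fact_numeral)
    finally have "ln (fact n :: real) \<le> ln (2 ^ 26)" by (subst ln_le_cancel_iff) auto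
    also have "\<dots> \<le> 20" using ln2_le_25_over_36 by (subst ln_realpow) auto
    finally have "psi n \<le> 20" using psi_le_ln_fact[of n] by simp
    moreover have "0 \<le> 4 / 3 * cheb * n + 2 * (ln n)\<^sup>2" using cheb_ge by simp
    ultimately show ?thesis by linarith
  next
    case False
    define k where "k = n div 4"
    have k: "1 \<le> k" "k < n" using False by (auto simp: k_def)
    have kn: "real k \<le> real n / 4" unfolding k_def using of_nat_div_le_of_nat[of n 4, where 'a = real] by simp
    have "ln (real k) \<le> ln (real n / 4)" using k kn by (subst ln_le_cancel_iff) auto
    also have "\<dots> = ln n - 2 * ln 2" using False by (simp add: ln_div ln_4_12)
    also have "\<dots> \<le> ln n - 4 / 3" using ln2_ge_two_thirds by simp
    finally have "(ln (real k))\<^sup>2 \<le> (ln n - 4 / 3)\<^sup>2" using k by (intro power_mono) auto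
    \<comment> \<open>Doubled, the square drops by 16/3 ln n - 32/9, which covers the error 5 ln n -
      6 of this step.\<close>
    moreover have "(ln (real n) - 4 / 3)\<^sup>2 = (ln n)\<^sup>2 - 8 / 3 * ln n + 16 / 9"
      by (simp add: power2_eq_square algebra_simps)
    moreover have "psi n \<le> psi k + cheb * n + 5 * ln n - 6"
      using psi_diff_le_alpha[of n] alpha_bounds(2)[of n] False by (simp add: k_def)
    moreover have "psi k \<le> 4 / 3 * cheb * k + 2 * (ln k)\<^sup>2 + 20" using less.IH k by blast
    moreover have "4 / 3 * cheb * k \<le> 4 / 3 * cheb * (n / 4)"
      using kn cheb_ge by (intro mult_left_mono) auto
    moreover have "ln (real n) \<ge> 0" using False by simp
    ultimately show ?thesis by (simp add: algebra_simps)
  qed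
qed

section \<open>Primes between \<open>x\<close> and \<open>m\<close>\<close>

text \<open>Only proper prime powers contribute. Their bases are at most \<open>sqrt m\<close>, so
  each weight is at most \<open>ln m / 2\<close>, and mapping a power to its base is
  injective.\<close>

lemma psi_diff_no_primes:
  assumes x: "1 \<le> x" "x \<le> m" "m \<le> 2 * x"
    and no_prime: "\<And>p. prime p \<Longrightarrow> x < p \<Longrightarrow> \<not> p \<le> m"
  shows "psi m \<le> psi x + sqrt m * (ln m / 2)"
proof -
  \<comment> \<open>All \<open>d \<in> S\<close> are proper powers; since \<open>m \<le> 2 * x\<close>, each prime has at most one power in \<open>S\<close>.\<close>
  define S where "S = {d \<in> {x<..m}. primepow d}"
  have dec: "\<exists>p k. prime p \<and> 2 \<le> k \<and> d = p ^ k \<and> aprimedivisor d = p" if "d \<in> S" for d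
  proof -
    from that obtain p k where pk: "prime p" "k > 0" "d = p ^ k"
      by (auto simp: S_def primepow_def)
    have "k \<noteq> 1"
    proof
      assume "k = 1"
      then have "d = p" using pk by simp
      then show False using no_prime[of p] that pk by (auto simp: S_def)
    qed
    then show ?thesis using pk by (intro exI[of _ p] exI[of _ k]) (auto simp: aprimedivisor_prime_power)
  qed
  have sq: "(aprimedivisor d)\<^sup>2 \<le> m" "aprimedivisor d \<ge> 2" if "d \<in> S" for d
  proof -
    from dec[OF that] obtain p k
      where pk: "prime p" "2 \<le> k" "d = p ^ k" "aprimedivisor d = p" by blast
    show "aprimedivisor d \<ge> 2" using pk by (simp add: prime_ge_2_nat)
    have "p\<^sup>2 \<le> p ^ k" using pk prime_ge_2_nat[OF pk(1)] by (intro power_increasing) auto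
    then show "(aprimedivisor d)\<^sup>2 \<le> m" using pk that by (auto simp: S_def)
  qed
  have gap: False if "prime p" "a < b" "x < p ^ a" "p ^ b \<le> m" for p a b :: nat
  proof -
    have "2 * p ^ a \<le> p ^ Suc a" using prime_ge_2_nat[OF that(1)] by simp
    also have "\<dots> \<le> p ^ b" using that prime_ge_2_nat[OF that(1)] by (intro power_increasing) auto
    finally show False using that x by linarith
  qed
  have "inj_on aprimedivisor S"
  proof (rule inj_onI)
    fix c d assume cd: "c \<in> S" "d \<in> S" "aprimedivisor c = aprimedivisor d"
    obtain p a where 1: "prime p" "c = p ^ a" "aprimedivisor c = p" using dec[OF cd(1)] by blast
    obtain b where 2: "d = p ^ b" using dec[OF cd(2)] cd(3) 1 by auto
    have "\<not> a < b" "\<not> b < a" using gap[of p a b] gap[of p b a] cd 1 2 by (auto simp: S_def)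
    then show "c = d" using 1 2 by simp
  qed
  moreover have "aprimedivisor ` S \<subseteq> {1..nat \<lfloor>sqrt m\<rfloor>}"
  proof safe
    fix d assume d: "d \<in> S"
    have "(real (aprimedivisor d))\<^sup>2 \<le> real m"
      using sq(1)[OF d] by (metis of_nat_le_iff of_nat_power)
    then have "real (aprimedivisor d) \<le> sqrt m" by (rule real_le_rsqrt)
    then show "aprimedivisor d \<in> {1..nat \<lfloor>sqrt m\<rfloor>}"
      using sq(2)[OF d] by (simp add: le_nat_floor)
  qed
  ultimately have "card S \<le> card {1..nat \<lfloor>sqrt m\<rfloor>}" by (intro card_inj_on_le) auto
  then have "real (card S) \<le> real (nat \<lfloor>sqrt m\<rfloor>)" by (simp only: card_atLeastAtMost of_nat_le_iff)
  also have "\<dots> \<le> sqrt m" by (rule of_nat_floor) simp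
  finally have card: "real (card S) \<le> sqrt m" .
  have "psi m = psi x + (\<Sum>d\<in>{x<..m}. mangoldt d)"
    unfolding psi_def using x by (subst sum.union_disjoint[symmetric]) (auto intro!: sum.cong)
  also have "(\<Sum>d\<in>{x<..m}. mangoldt d) = (\<Sum>d\<in>S. mangoldt d :: real)"
    by (rule sum.mono_neutral_right) (auto simp: S_def mangoldt_def)
  also have "\<dots> \<le> (\<Sum>d\<in>S. ln m / 2)"
  proof (rule sum_mono)
    fix d assume d: "d \<in> S"
    have "2 * ln (real (aprimedivisor d)) = ln ((real (aprimedivisor d))\<^sup>2)"
      using sq(2)[OF d] by (simp add: ln_realpow)
    also have "\<dots> \<le> ln (real m)"
      using sq[OF d] x by (subst ln_le_cancel_iff) (auto simp flip: of_nat_power)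
    finally show "mangoldt d \<le> ln m / 2" using d by (simp add: S_def mangoldt_def)
  qed
  also have "\<dots> \<le> sqrt m * (ln m / 2)"
    using card x by (simp add: mult_right_mono)
  finally show ?thesis by simp
qed

lemma prime_between:
  fixes x m :: nat
  assumes "8 * x \<le> 5 * m" "m \<le> 2 * x" "m \<ge> 10000"
  shows "\<exists>p. prime p \<and> x < p \<and> p \<le> m"
proof (rule ccontr)
  assume "\<not> ?thesis"
  then have no_prime: "\<And>p. prime p \<Longrightarrow> x < p \<Longrightarrow> \<not> p \<le> m" by blast
  define s where "s = sqrt m"
  define L where "L = ln (real m)"
  have x: "1 \<le> x" "x \<le> m" using assms by auto
  have s: "100 \<le> s" unfolding s_def by (rule real_le_rsqrt) (use assms in simp)
  have ms: "real m = s * s" by (simp add: s_def)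
  have L: "L = 2 * ln s" using s unfolding L_def ms by (subst ln_mult) auto
  \<comment> \<open>The tangent of ln at 100, with 100 \<le> 2^7, bounds every error by a polynomial
    in \<open>s\<close>; L \<le> s/10 holds from s = 100 on, hence the threshold 10000.\<close>
  have "ln s - ln 100 \<le> (s - 100) / 100" using s by (intro ln_diff_le) auto
  moreover have "ln (100::real) \<le> 7 * ln 2"
  proof -
    have "ln (100::real) \<le> ln (2 ^ 7)" by (subst ln_le_cancel_iff) auto
    also have "\<dots> = 7 * ln 2" by (subst ln_realpow) auto
    finally show ?thesis .
  qed
  ultimately have Ls: "L \<le> s / 10" using ln2_le_25_over_36 s unfolding L by simp
  have L0: "0 \<le> L" using assms by (simp add: L_def)
  have "cheb * m - 4 * L \<le> psi m"
    using alpha_bounds(1)[of m] alpha_le_psi[of m] assms by (simp add: L_def)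
  also have "\<dots> \<le> psi x + s * (L / 2)"
    using psi_diff_no_primes[OF x assms(2) no_prime] by (simp add: s_def L_def)
  also have "psi x \<le> 4 / 3 * cheb * x + 2 * (ln x)\<^sup>2 + 20" by (rule psi_upper[OF x(1)])
  also have "(ln (real x))\<^sup>2 \<le> L\<^sup>2" unfolding L_def using x by (intro power_mono) auto
  also have "4 / 3 * cheb * x \<le> 4 / 3 * cheb * (5 / 8 * m)"
    using assms cheb_ge by (intro mult_left_mono) auto
  \<comment> \<open>Since 4/3 * 5/8 = 5/6, a sixth of the main term survives.\<close>
  finally have "cheb * (s * s) / 6 \<le> 4 * L + 2 * L\<^sup>2 + 20 + s * L / 2"
    unfolding ms by (simp add: algebra_simps)
  moreover have "4 / 5 * (s * s) \<le> cheb * (s * s)" using cheb_ge by (intro mult_right_mono) auto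
  moreover have "L\<^sup>2 \<le> s * s / 100"
    using power_mono[OF Ls L0, of 2] by (simp add: power2_eq_square)
  moreover have "s * L \<le> s * s / 10" using mult_left_mono[OF Ls, of s] s by simp
  moreover have "100 * s \<le> s * s" using s by (intro mult_right_mono) auto
  moreover have "10000 \<le> s * s" using mult_mono[OF s s] s by simp
  \<comment> \<open>In units of s^2 the left side is at least 2/15, while the errors total at most
    0.004 + 0.02 + 0.002 + 0.05.\<close>
  ultimately show False using Ls by linarith
qed

section \<open>Primes between consecutive Fibonacci numbers\<close>

lemma fib_values:
  "fib 3 = 2" "fib 4 = 3" "fib 5 = 5" "fib 6 = 8" "fib 7 = 13" "fib 8 = 21"
  "fib 9 = 34" "fib 10 = 55" "fib 11 = 89" "fib 12 = 144" "fib 13 = 233" "fib 14 = 377"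
  "fib 15 = 610" "fib 16 = 987" "fib 17 = 1597" "fib 18 = 2584" "fib 19 = 4181" "fib 20 = 6765"
  "fib 21 = 10946"
  by (simp_all add: fib.simps(3)[of "numeral k" for k, simplified] eval_nat_numeral(2,3))

text \<open>The inequality is linear, so the recurrence carries it on from n = 4 and n = 5. It is an
  equality at n = 5 and fails at n = 3.\<close>

lemma fib_ratio:
  assumes "n \<ge> 4"
  shows "8 * fib n \<le> 5 * fib (Suc n)" and "fib (Suc n) \<le> 2 * fib n"
proof -
  obtain k where k: "n = k + 4" using assms by (metis add.commute le_Suc_ex)
  have "8 * fib (k + 4) \<le> 5 * fib (Suc (k + 4))"
    by (induction k rule: fib.induct) (simp_all add: numeral_eq_Suc)
  then show "8 * fib n \<le> 5 * fib (Suc n)" by (simp add: k)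
  have "fib n = fib (n - 1) + fib (n - 2)" "fib (Suc n) = fib n + fib (n - 1)"
    by (auto simp: k numeral_eq_Suc)
  then show "fib (Suc n) \<le> 2 * fib n" by simp
qed

text \<open>Trial division over an explicit list. The guard \<open>d < p\<close> lets one list serve
  primes of every size, including those that occur in it.\<close>

lemma prime_if_no_divisor_below:
  fixes p k :: nat
  assumes "2 \<le> p" "p < (Suc k)\<^sup>2" "\<And>d. d \<in> set [2..<Suc k] \<Longrightarrow> d < p \<Longrightarrow> \<not> d dvd p"
  shows "prime p"
proof -
  have "d = 1" if d: "d dvd p" "d\<^sup>2 \<le> p" for d
  proof (rule ccontr)
    assume "d \<noteq> 1"
    moreover have "d \<noteq> 0" using d assms(1) by (cases "d = 0") auto
    ultimately have 2: "2 \<le> d" by simp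
    then have "d < d\<^sup>2" by (simp add: power2_eq_square)
    then have "d < p" using d(2) by simp
    moreover have "d < Suc k"
      using d(2) assms(2) by (intro power_less_imp_less_base[of d 2 "Suc k"]) auto
    moreover have "d \<in> set [2..<Suc k]" using \<open>d < Suc k\<close> 2 by (simp only: set_upt atLeastLessThan_iff)
    ultimately show False using assms(3)[of d] d by blast
  qed
  then show ?thesis using assms(1) unfolding prime_divisor_sqrt[of p] by simp
qed

text \<open>F_21 = 10946 is the first Fibonacci number above 10000, so n \<ge> 20 falls to
  \<open>prime_between\<close>. At n = 1 the interval is empty.\<close>

lemma prime_between_fib:
  assumes "n \<ge> 2"
  shows "\<exists>p. prime p \<and> fib n < p \<and> p \<le> fib (Suc n)"
proof (cases "n \<ge> 20")
  case True
  have "fib 21 \<le> fib (Suc n)" using True by (intro fib_mono) simp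
  then show ?thesis using True fib_ratio[of n] by (intro prime_between) (simp_all add: fib_values)
next
  case False
  \<comment> \<open>Each pair holds an index n and a prime witness in the interval from F_n to
    F_(n+1).\<close>
  define ws :: "(nat \<times> nat) list" where
    "ws = [(2, 2), (3, 3), (4, 5), (5, 7), (6, 13), (7, 17), (8, 29), (9, 53), (10, 89), (11, 97),
      (12, 233), (13, 239), (14, 379), (15, 613), (16, 1597), (17, 1601), (18, 2591), (19, 4201)]"
  have "prime p" if p: "p \<in> snd ` set ws" for p
  \<comment> \<open>65^2 = 4225 exceeds the largest witness, 4201.\<close>
  proof (rule prime_if_no_divisor_below[of p 64])
    show "\<not> d dvd p" if d: "d \<in> set [2..<Suc 64]" "d < p" for d
    proof -
      have "list_all (\<lambda>p. list_all (\<lambda>d. d < p \<longrightarrow> p mod d \<noteq> 0) [2..<Suc 64]) (map snd ws)"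
        by (simp add: ws_def)
      then have "\<forall>p\<in>snd ` set ws. \<forall>d\<in>set [2..<Suc 64]. d < p \<longrightarrow> p mod d \<noteq> 0"
        unfolding list_all_iff set_map .
      then show ?thesis using d p by (simp only: dvd_eq_mod_eq_0) blast
    qed
  qed (use that in \<open>auto simp: ws_def\<close>)
  then have *: "\<forall>(n, p) \<in> set ws. prime p" by force
  have **: "\<forall>(n, p) \<in> set ws. fib n < p \<and> p \<le> fib (Suc n)"
    by (simp add: ws_def fib_values)
  have "n \<in> fst ` set ws"
    using False assms by (simp add: ws_def) presburger
  then obtain p where "(n, p) \<in> set ws" by force
  with * ** show ?thesis by blast
qed

theorem theorem4:
  fixes n :: nat
  assumes "n \<ge> 2"
  shows "card {d :: nat. d dvd fact (fib (n + 1))} \<ge> card {d :: nat. d dvd fact (fib n)} + 1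
       \<and> card {p :: nat. prime p \<and> p \<le> fib (n + 1)} \<ge> card {p :: nat. prime p \<and> p \<le> fib n} + 1"
proof -
  obtain p where p: "prime p" "fib n < p" "p \<le> fib (n + 1)"
    using prime_between_fib[OF assms] by auto
  have "{d :: nat. d dvd fact (fib n)} \<subset> {d. d dvd fact (fib (n + 1))}"
  proof
    show "{d :: nat. d dvd fact (fib n)} \<subseteq> {d. d dvd fact (fib (n + 1))}"
      using p fact_dvd[of "fib n" "fib (n + 1)"] by (auto intro: dvd_trans)
    \<comment> \<open>A prime divides m! iff it is at most m, so \<open>p\<close> itself is a new
      divisor.\<close>
    have "p dvd fact (fib (n + 1))" "\<not> p dvd fact (fib n)"
      using p by (auto simp: prime_dvd_fact_iff)
    then show "{d :: nat. d dvd fact (fib n)} \<noteq> {d. d dvd fact (fib (n + 1))}" by blast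
  qed
  then have "card {d :: nat. d dvd fact (fib n)} < card {d :: nat. d dvd fact (fib (n + 1))}"
    by (intro psubset_card_mono finite_divisors_nat) auto
  moreover have "{q. prime q \<and> q \<le> fib n} \<subset> {q. prime q \<and> q \<le> fib (n + 1)}"
  proof
    show "{q. prime q \<and> q \<le> fib n} \<subseteq> {q. prime q \<and> q \<le> fib (n + 1)}" using p by auto
    have "p \<in> {q. prime q \<and> q \<le> fib (n + 1)}" "p \<notin> {q. prime q \<and> q \<le> fib n}" using p by auto
    then show "{q. prime q \<and> q \<le> fib n} \<noteq> {q. prime q \<and> q \<le> fib (n + 1)}" by blast
  qed
  then have "card {q. prime q \<and> q \<le> fib n} < card {q. prime q \<and> q \<le> fib (n + 1)}"
    by (intro psubset_card_mono) auto
  ultimately show ?thesis by simp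
qed

end
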